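(* Let $k$ be a field, let $A$ be a unital associative (not necessarily commutative) $k$-algebra, let $u\in A$ be a separable element, and let $p=p_1^{m_1}\cdots p_r^{m_r}\in k[x]$ be a monic annihilating polynomial of $u$, where $p_1,\dots,p_r$ are the distinct monic irreducible factors of $p$ (with $m_j\ge 1$), all of which are assumed to be separable polynomials. Set $m=\max_{1\le j\le r}m_j$, $\tilde p=p_1\cdots p_r$ and $\overline p=p/\tilde p$. Then $\tilde p$ is separable, and there exists $q\in k[x]$ such that $q\,\tilde p'\equiv 1 \pmod{\overline p}$. For any such $q$, define a sequence $(d_n)_{n\ge 0}$ of elements of $A$ by $$d_0=u,\qquad d_{n+1}=d_n-\tilde p(d_n)\,q(d_n)\quad (n\ge 0),$$ and let $N$ be the smallest integer such that $2^N\ge m$. Then $\tilde p(d_N)=0$, $d_N$ is absolutely semisimple, $u-d_N$ is nilpotent, $[d_N,u-d_N]=0$, and $(d_N,u-d_N)$ is the unique Jordan-Chevalley decomposition of $u$ in $A$.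
   Context: Fields are commutative. A non-constant polynomial $f\in k[x]$ is called separable if it is coprime to its formal derivative $f'$. For $A$ a unital $k$-algebra with unit $1_A$, $u,v\in A$ and $f=f_0+f_1x+\dots+f_nx^n\in k[x]$, write $[u,v]=uv-vu$ and $f(u)=f_0 1_A+f_1u+\dots+f_nu^n$; $f$ is an annihilating polynomial of $u$ if $f(u)=0$. Irreducible factors of a polynomial are taken to be monic. An element $u\in A$ is absolutely semisimple if it has an annihilating polynomial that is separable. An element $u\in A$ is separable if it has a (nonzero) annihilating polynomial in $k[x]$ all of whose irreducible factors are separable polynomials. A Jordan-Chevalley decomposition of $u\in A$ is a pair $(d,s)$ of elements of $A$ with $d$ absolutely semisimple, $s$ nilpotent, $u=d+s$ and $[d,s]=0$. *)

theory Defs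
  imports "HOL-Computational_Algebra.Polynomial" "HOL-Number_Theory.Cong"
begin

text \<open>The sort \<open>{ring, monoid_mult}\<close> is used instead of \<open>ring_1\<close>, whose axiom
  \<open>0 \<noteq> 1\<close> would exclude the zero algebra.\<close>

locale unital_algebra = vector_space scale
  for scale :: "'k::field \<Rightarrow> 'a::{ring, monoid_mult} \<Rightarrow> 'a" +
  assumes scale_mult_left: "scale c x * y = scale c (x * y)"
    and scale_mult_right: "x * scale c y = scale c (x * y)"

definition alg_eval :: "('k::field \<Rightarrow> 'a::{ring, monoid_mult} \<Rightarrow> 'a) \<Rightarrow> 'k poly \<Rightarrow> 'a \<Rightarrow> 'a" where
  "alg_eval scale f u = (\<Sum>i\<le>degree f. scale (coeff f i) (u ^ i))"

definition separable_poly :: "'k::field poly \<Rightarrow> bool" where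
  "separable_poly f \<longleftrightarrow> degree f > 0 \<and> coprime f (pderiv f)"

definition commutator :: "'a::ring \<Rightarrow> 'a \<Rightarrow> 'a" where
  "commutator u v = u * v - v * u"

definition nilpotent :: "'a::{ring, monoid_mult} \<Rightarrow> bool" where
  "nilpotent s \<longleftrightarrow> (\<exists>n>0. s ^ n = 0)"

definition absolutely_semisimple ::
  "('k::field \<Rightarrow> 'a::{ring, monoid_mult} \<Rightarrow> 'a) \<Rightarrow> 'a \<Rightarrow> bool" where
  "absolutely_semisimple scale u \<longleftrightarrow> (\<exists>f. separable_poly f \<and> alg_eval scale f u = 0)"

definition separable_element ::
  "('k::field \<Rightarrow> 'a::{ring, monoid_mult} \<Rightarrow> 'a) \<Rightarrow> 'a \<Rightarrow> bool" where
  "separable_element scale u \<longleftrightarrow>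
     (\<exists>f. f \<noteq> 0 \<and> alg_eval scale f u = 0 \<and>
          (\<forall>g. irreducible g \<and> lead_coeff g = 1 \<and> g dvd f \<longrightarrow> separable_poly g))"

definition Jordan_Chevalley ::
  "('k::field \<Rightarrow> 'a::{ring, monoid_mult} \<Rightarrow> 'a) \<Rightarrow> 'a \<Rightarrow> 'a \<Rightarrow> 'a \<Rightarrow> bool" where
  "Jordan_Chevalley scale u d s \<longleftrightarrow>
     absolutely_semisimple scale d \<and> nilpotent s \<and> u = d + s \<and> commutator d s = 0"

primrec newton_seq ::
  "('k::field \<Rightarrow> 'a::{ring, monoid_mult} \<Rightarrow> 'a) \<Rightarrow> 'k poly \<Rightarrow> 'k poly \<Rightarrow> 'a \<Rightarrow> nat \<Rightarrow> 'a" where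
  "newton_seq scale f q u 0 = u"
| "newton_seq scale f q u (Suc n) =
     newton_seq scale f q u n
       - alg_eval scale f (newton_seq scale f q u n) * alg_eval scale q (newton_seq scale f q u n)"

end

theory Submission
  imports Defs
begin

text \<open>
  The iteration can be run in \<open>k[x]\<close>, starting from \<open>x\<close>, and evaluated at \<open>u\<close> afterwards. There
  \<open>D\<^sub>n \<equiv> x\<close> modulo \<open>p~\<close>, so \<open>p\<close> divides \<open>p(D\<^sub>n)\<close>. Writing \<open>1 - q p~' = p\<^sub>b h\<close> with
  \<open>p\<^sub>b = p / p~\<close>, Taylor's formula
  gives \<open>p~(D\<^sub>n\<^sub>+\<^sub>1) \<equiv> p(D\<^sub>n) h(D\<^sub>n)\<close> modulo \<open>p~(D\<^sub>n)\<^sup>2\<close>, hence modulo \<open>p\<close> the polynomial \<open>p~(D\<^sub>n)\<close> is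
  a multiple of \<open>p~\<close> to the power \<open>2\<^sup>n\<close>, and \<open>p\<close> divides the latter for \<open>n = N\<close>.

  For uniqueness, let \<open>d'\<close> be the semisimple part of another decomposition. It commutes with
  \<open>d\<^sub>N\<close>, a polynomial in \<open>u\<close>, and \<open>e = d' - d\<^sub>N\<close> is nilpotent. Thus \<open>p~(d')\<close> is nilpotent, and it
  vanishes because a separable polynomial annihilates \<open>d'\<close>. Taylor's formula now reads
  \<open>0 = e p~'(d\<^sub>N) + e\<^sup>2 w\<close> with \<open>p~'(d\<^sub>N)\<close> invertible, which forces \<open>e = 0\<close>.
\<close>

section \<open>Comaximal elements\<close>

text \<open>Coprimality in Bezout form: the identity survives evaluation in an algebra, where it
  produces inverses.\<close>

definition comaximal :: "'a::comm_ring_1 \<Rightarrow> 'a \<Rightarrow> bool" where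
  "comaximal a b \<longleftrightarrow> (\<exists>x y. x * a + y * b = 1)"

lemma comaximal_sym: "comaximal a b \<Longrightarrow> comaximal b a"
  unfolding comaximal_def by (metis add.commute)

lemma comaximal_imp_coprime:
  assumes "comaximal a b"
  shows "coprime a b"
proof (rule coprimeI)
  fix c assume "c dvd a" "c dvd b"
  moreover obtain x y where "x * a + y * b = 1" using assms by (auto simp: comaximal_def)
  ultimately show "is_unit c" by (metis dvd_add dvd_mult)
qed

lemma comaximal_mult_right:
  assumes "comaximal a b" "comaximal a c"
  shows "comaximal a (b * c)"
proof -
  obtain x y z w where 1: "x * a + y * b = 1" and 2: "z * a + w * c = 1"
    using assms by (auto simp: comaximal_def)
  have "(x * z * a + x * w * c + y * b * z) * a + (y * w) * (b * c)
      = (x * a + y * b) * (z * a + w * c)"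
    by (simp add: algebra_simps)
  then show ?thesis unfolding comaximal_def using 1 2 by (metis mult_1)
qed

lemma comaximal_one_right: "comaximal a 1"
  unfolding comaximal_def by (rule exI[of _ 0], rule exI[of _ 1]) simp

lemma comaximal_power_right: "comaximal a b \<Longrightarrow> comaximal a (b ^ n)"
  by (induction n) (auto intro: comaximal_mult_right comaximal_one_right)

lemma comaximal_prod_right: "(\<And>j. j \<in> J \<Longrightarrow> comaximal a (f j)) \<Longrightarrow> comaximal a (prod f J)"
  by (induction J rule: infinite_finite_induct)
    (auto intro: comaximal_mult_right comaximal_one_right)

lemma comaximal_dvd_right:
  assumes "comaximal a b" "c dvd b"
  shows "comaximal a c"
proof -
  obtain x y where 1: "x * a + y * b = 1" using assms by (auto simp: comaximal_def)
  obtain k where "b = c * k" using assms by (auto elim: dvdE)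
  then have "x * a + (y * k) * c = 1" using 1 by (simp add: algebra_simps)
  then show ?thesis unfolding comaximal_def by blast
qed

lemma comaximal_add_mult_right:
  assumes "comaximal a b"
  shows "comaximal a (b + a * c)"
proof -
  obtain x y where 1: "x * a + y * b = 1" using assms by (auto simp: comaximal_def)
  have "(x - y * c) * a + y * (b + a * c) = 1" using 1 by (simp add: algebra_simps)
  then show ?thesis unfolding comaximal_def by blast
qed

text \<open>Extended Euclidean algorithm: the combination is a gcd, fixed only up to units.\<close>

lemma bezout_euclidean_ring:
  fixes a b :: "'a::euclidean_ring"
  shows "\<exists>x y. x * a + y * b dvd a \<and> x * a + y * b dvd b"
proof (induction "euclidean_size b" arbitrary: a b rule: less_induct)
  case less
  show ?case
  proof (cases "b = 0")
    case True
    then show ?thesis by (intro exI[of _ 1] exI[of _ 0]) simp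
  next
    case False
    then obtain x y where xy: "x * b + y * (a mod b) dvd b" "x * b + y * (a mod b) dvd a mod b"
      using less[of "a mod b" b] mod_size_less by blast
    then have "x * b + y * (a mod b) dvd a" by (simp add: dvd_mod_iff)
    moreover have "x * b + y * (a mod b) = y * a + (x - y * (a div b)) * b"
      by (simp add: algebra_simps flip: minus_div_mult_eq_mod)
    ultimately show ?thesis using xy by metis
  qed
qed

lemma coprime_imp_comaximal:
  fixes a b :: "'a::euclidean_ring"
  assumes "coprime a b"
  shows "comaximal a b"
proof -
  obtain x y where xy: "x * a + y * b dvd a" "x * a + y * b dvd b"
    using bezout_euclidean_ring by blast
  then have "is_unit (x * a + y * b)" using assms by (rule coprime_common_divisor[rotated])
  then obtain k where "1 = (x * a + y * b) * k" by (auto elim: dvdE)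
  then have "(k * x) * a + (k * y) * b = 1" by (simp add: algebra_simps)
  then show ?thesis unfolding comaximal_def by blast
qed

section \<open>Separable polynomials\<close>

lemma separable_poly_iff_comaximal:
  "separable_poly f \<longleftrightarrow> degree f > 0 \<and> comaximal f (pderiv f)"
  unfolding separable_poly_def using coprime_imp_comaximal comaximal_imp_coprime by blast

text \<open>Modulo \<open>f\<close> the derivative of the product is \<open>g * pderiv f\<close>,
  and both factors are comaximal to \<open>f\<close>; likewise modulo \<open>g\<close>.\<close>

lemma comaximal_pderiv_mult:
  fixes f g :: "'k::field poly"
  assumes "comaximal f (pderiv f)" "comaximal g (pderiv g)" "comaximal f g"
  shows "comaximal (f * g) (pderiv (f * g))"
proof -
  have f: "comaximal f (pderiv (f * g))"
    using comaximal_add_mult_right[OF comaximal_mult_right[OF assms(3,1)], of "pderiv g"]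
    by (simp add: pderiv_mult algebra_simps)
  have g: "comaximal g (pderiv (f * g))"
    using comaximal_add_mult_right
      [OF comaximal_mult_right[OF comaximal_sym[OF assms(3)] assms(2)], of "pderiv f"]
    by (simp add: pderiv_mult algebra_simps)
  show ?thesis by (rule comaximal_sym[OF comaximal_mult_right[OF comaximal_sym[OF f] comaximal_sym[OF g]]])
qed

lemma comaximal_pderiv_prod:
  fixes f :: "'i \<Rightarrow> 'k::field poly"
  assumes "finite J"
    and "\<And>j. j \<in> J \<Longrightarrow> comaximal (f j) (pderiv (f j))"
    and "\<And>i j. i \<in> J \<Longrightarrow> j \<in> J \<Longrightarrow> i \<noteq> j \<Longrightarrow> comaximal (f i) (f j)"
  shows "comaximal (prod f J) (pderiv (prod f J))"
  using assms
proof (induction J rule: finite_induct)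
  case empty
  then show ?case by (simp add: comaximal_sym comaximal_one_right)
next
  case (insert i J)
  have "comaximal (f i) (prod f J)"
    using insert.hyps insert.prems by (intro comaximal_prod_right) auto
  then show ?case
    using insert by (auto intro!: comaximal_pderiv_mult)
qed

lemma monic_dvd_antisym:
  fixes f g :: "'k::field poly"
  assumes "f dvd g" "g dvd f" "lead_coeff f = 1" "lead_coeff g = 1"
  shows "f = g"
proof -
  have nz: "f \<noteq> 0" "g \<noteq> 0" using assms by auto
  obtain k where k: "g = f * k" using assms by (auto elim: dvdE)
  have "degree f = degree g" using assms nz by (simp add: dvd_imp_degree_le le_antisym)
  then have "degree k = 0" using k nz by (simp add: degree_mult_eq)
  moreover have "lead_coeff k = 1" using assms k by (simp add: lead_coeff_mult)
  ultimately have "k = 1" by (auto elim!: degree_eq_zeroE simp: one_pCons)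
  then show ?thesis using k by simp
qed

text \<open>A common divisor that is not a unit is divisible by both irreducible polynomials, so
  these divide each other; being monic, they coincide.\<close>

lemma comaximal_monic_irreducible:
  fixes f g :: "'k::field poly"
  assumes "irreducible f" "irreducible g" "lead_coeff f = 1" "lead_coeff g = 1" "f \<noteq> g"
  shows "comaximal f g"
proof (intro coprime_imp_comaximal coprimeI)
  fix c assume c: "c dvd f" "c dvd g"
  show "is_unit c"
  proof (rule ccontr)
    assume "\<not> is_unit c"
    then have "f dvd c" "g dvd c" using c assms irreducibleD' by blast+
    then have "f dvd g" "g dvd f" using c dvd_trans by blast+
    then show False using assms monic_dvd_antisym by blast
  qed
qed

text \<open>Separable polynomials are squarefree: with \<open>t = gcd(f, g)\<close>, the cofactor \<open>f / t\<close> is coprime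
  to \<open>g\<close>, so the power of \<open>g\<close> can be dropped.\<close>

lemma separable_poly_dvd_lincomb_power:
  fixes f g :: "'k::field poly"
  assumes "comaximal f (pderiv f)"
  shows "\<exists>t a b. t = a * f + b * g ^ n \<and> t dvd g"
proof -
  obtain x y where xy: "x * f + y * g dvd f" "x * f + y * g dvd g"
    using bezout_euclidean_ring by blast
  define t where "t = x * f + y * g"
  obtain w z where w: "f = t * w" and z: "g = t * z"
    using xy unfolding t_def by (meson dvdE)
  have "f \<noteq> 0"
  proof
    assume "f = 0"
    then show False using assms by (simp add: comaximal_def)
  qed
  then have "t \<noteq> 0" using w by auto
  have "t * (x * w + y * z) = x * (t * w) + y * (t * z)" by (simp add: algebra_simps)
  also have "\<dots> = t * 1" by (simp only: w[symmetric] z[symmetric] t_def[symmetric] mult_1_right)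
  finally have "t * (x * w + y * z) = t * 1" .
  then have "x * w + y * z = 1" using \<open>t \<noteq> 0\<close> mult_cancel_left by blast
  then have wz: "comaximal w z" unfolding comaximal_def by blast
  \<comment> \<open>As \<open>f = t * w\<close>, its derivative is \<open>t * pderiv w\<close>
    modulo \<open>w\<close>; the Bezout identity for \<open>f\<close> and \<open>pderiv f\<close>
    thus makes \<open>t\<close> invertible modulo \<open>w\<close>.\<close>
  obtain a b where ab: "a * f + b * pderiv f = 1" using assms by (auto simp: comaximal_def)
  have "(a * t + b * pderiv t) * w + (b * pderiv w) * t = 1"
    using ab by (simp add: w pderiv_mult algebra_simps)
  then have "comaximal w t" unfolding comaximal_def by blast
  then have "comaximal w (g ^ n)" using wz z by (auto intro: comaximal_power_right comaximal_mult_right)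
  then obtain a' b' where "a' * w + b' * g ^ n = 1" by (auto simp: comaximal_def)
  then have "t * (a' * w + b' * g ^ n) = t" by simp
  then have "t = a' * f + (t * b') * g ^ n" by (simp add: w algebra_simps)
  then show ?thesis using xy(2) unfolding t_def by blast
qed

section \<open>Evaluation in an algebra\<close>

context unital_algebra
begin

lemma alg_eval_0: "alg_eval scale 0 u = 0"
  by (simp add: alg_eval_def)

lemma alg_eval_extend:
  assumes "degree f \<le> n"
  shows "alg_eval scale f u = (\<Sum>i\<le>n. scale (coeff f i) (u ^ i))"
  unfolding alg_eval_def
  using assms by (intro sum.mono_neutral_left) (auto simp: coeff_eq_0)

text \<open>Horner recursion, the base of the inductions on polynomials below.\<close>

lemma alg_eval_pCons: "alg_eval scale (pCons a f) u = scale a 1 + u * alg_eval scale f u"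
proof -
  have "alg_eval scale (pCons a f) u = (\<Sum>i\<le>Suc (degree f). scale (coeff (pCons a f) i) (u ^ i))"
    by (rule alg_eval_extend) (simp add: degree_pCons_le)
  also have "\<dots> = scale a 1 + (\<Sum>i\<le>degree f. scale (coeff f i) (u * u ^ i))"
    by (subst sum.atMost_Suc_shift) simp
  also have "\<dots> = scale a 1 + u * alg_eval scale f u"
    by (simp add: alg_eval_def sum_distrib_left scale_mult_right)
  finally show ?thesis .
qed

lemma alg_eval_1: "alg_eval scale 1 u = 1"
  by (simp add: one_pCons alg_eval_pCons alg_eval_0)

lemma alg_eval_X: "alg_eval scale [:0, 1:] u = u"
  by (simp add: alg_eval_pCons alg_eval_0)

lemma alg_eval_add: "alg_eval scale (f + g) u = alg_eval scale f u + alg_eval scale g u"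
  by (induction f g rule: poly_induct2)
    (simp_all add: alg_eval_0 alg_eval_pCons scale_left_distrib algebra_simps)

lemma alg_eval_smult: "alg_eval scale (smult c f) u = scale c (alg_eval scale f u)"
  by (induction f)
    (simp_all add: alg_eval_0 alg_eval_pCons scale_right_distrib scale_mult_right)

lemma alg_eval_diff: "alg_eval scale (f - g) u = alg_eval scale f u - alg_eval scale g u"
  using alg_eval_add[of "f - g" g u] by simp

lemma alg_eval_mult: "alg_eval scale (f * g) u = alg_eval scale f u * alg_eval scale g u"
  by (induction f)
    (simp_all add: alg_eval_0 alg_eval_pCons alg_eval_add alg_eval_smult scale_mult_left
      distrib_right mult.assoc)

lemma alg_eval_power: "alg_eval scale (f ^ n) u = alg_eval scale f u ^ n"
  by (induction n) (simp_all add: alg_eval_1 alg_eval_mult)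

lemma alg_eval_pcompose: "alg_eval scale (pcompose f g) u = alg_eval scale f (alg_eval scale g u)"
  by (induction f)
    (simp_all add: alg_eval_0 alg_eval_pCons pcompose_pCons alg_eval_add alg_eval_mult)

lemma alg_eval_dvd_eq_0:
  assumes "alg_eval scale f u = 0" "f dvd g"
  shows "alg_eval scale g u = 0"
  using assms by (auto elim!: dvdE simp: alg_eval_mult)

lemma alg_eval_commute:
  assumes "v * u = u * v"
  shows "v * alg_eval scale f u = alg_eval scale f u * v"
proof (induction f)
  case 0
  then show ?case by (simp add: alg_eval_0)
next
  case (pCons a f)
  have "v * (u * alg_eval scale f u) = u * alg_eval scale f u * v"
    by (metis assms mult.assoc pCons.IH)
  then show ?case
    by (simp add: alg_eval_pCons distrib_left distrib_right scale_mult_left scale_mult_right)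
qed

text \<open>Only the first derivative enters and the remainder \<open>w\<close> is left unspecified,
  so the formula holds in every characteristic. Commutativity of \<open>x\<close> and
  \<open>y\<close> collects the factors \<open>y\<close> on the left.\<close>

lemma alg_eval_taylor:
  assumes "x * y = y * x"
  shows "\<exists>w. alg_eval scale f (x + y)
    = alg_eval scale f x + y * alg_eval scale (pderiv f) x + y * y * w"
proof (induction f)
  case 0
  then show ?case by (intro exI[of _ 0]) (simp add: alg_eval_0)
next
  case (pCons a f)
  then obtain w where w: "alg_eval scale f (x + y)
    = alg_eval scale f x + y * alg_eval scale (pderiv f) x + y * y * w" by blast
  define F G where "F = alg_eval scale f x" and "G = alg_eval scale (pderiv f) x"
  have xy: "x * (y * z) = y * (x * z)" for z by (metis assms mult.assoc)
  have "alg_eval scale (pCons a f) (x + y)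
      = alg_eval scale (pCons a f) x + y * (F + x * G) + y * y * (x * w + G + y * w)"
    by (simp add: alg_eval_pCons w algebra_simps xy flip: F_def G_def)
  then show ?case
    by (auto simp: pderiv_pCons alg_eval_add alg_eval_pCons F_def G_def)
qed

end

lemma unital_algebra_smult: "unital_algebra (smult :: 'k::field \<Rightarrow> 'k poly \<Rightarrow> 'k poly)"
  by unfold_locales (simp_all add: smult_add_right smult_add_left)

lemma alg_eval_smult_eq_pcompose: "alg_eval smult f g = pcompose f g"
proof -
  interpret P: unital_algebra "smult :: 'a \<Rightarrow> 'a poly \<Rightarrow> 'a poly" by (rule unital_algebra_smult)
  show ?thesis
    by (induction f) (simp_all add: P.alg_eval_0 P.alg_eval_pCons pcompose_pCons)
qed

text \<open>Evaluation at \<open>u\<close> is a homomorphism sending the indeterminate to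
  \<open>u\<close>, and it turns composition into evaluation, so it carries each Newton step
  over.\<close>

lemma (in unital_algebra) newton_seq_eq_alg_eval:
  "newton_seq scale f q u n = alg_eval scale (newton_seq smult f q [:0, 1:] n) u"
  by (induction n)
    (simp_all add: alg_eval_X alg_eval_diff alg_eval_mult alg_eval_smult_eq_pcompose
      alg_eval_pcompose)

section \<open>The Newton iteration in the polynomial ring\<close>

lemma pcompose_power: "pcompose (f ^ n) g = pcompose f g ^ n" for f :: "'k::comm_ring_1 poly"
  by (induction n) (simp_all add: pcompose_mult pcompose_1)

lemma cong_pcompose:
  fixes f :: "'k::field poly"
  assumes "[a = b] (mod c)"
  shows "[pcompose f a = pcompose f b] (mod c)"
  by (induction f) (auto simp: pcompose_pCons intro!: cong_add cong_mult assms)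

text \<open>Each step subtracts a multiple of \<open>f\<close> composed with the iterate, which is
  \<open>0\<close> modulo \<open>f\<close> while the iterate is congruent to the
  indeterminate.\<close>

lemma newton_seq_poly_cong_X:
  fixes f q :: "'k::field poly"
  shows "[newton_seq smult f q [:0, 1:] n = [:0, 1:]] (mod f)"
proof (induction n)
  case 0
  then show ?case by simp
next
  case (Suc n)
  let ?D = "newton_seq smult f q [:0, 1:] n"
  have "[pcompose f ?D = pcompose f [:0, 1:]] (mod f)" by (rule cong_pcompose[OF Suc])
  then have "[pcompose f ?D = 0] (mod f)" by (simp add: cong_def)
  then have "[?D - pcompose f ?D * pcompose q ?D = [:0, 1:] - 0 * pcompose q ?D] (mod f)"
    by (intro cong_diff cong_mult Suc cong_refl)
  then show ?case by (simp add: alg_eval_smult_eq_pcompose)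
qed

text \<open>The linear Taylor term carries a factor \<open>f\<close> besides the \<open>g\<close>
  that comes from \<open>q\<close>, so it is a multiple of \<open>p\<close> composed with the
  iterate and vanishes modulo \<open>p\<close>. The quadratic remainder doubles the exponent of
  \<open>f\<close>.\<close>

lemma newton_seq_poly_quadratic:
  fixes p f g q :: "'k::field poly"
  assumes p: "p = f * g" and q: "[q * pderiv f = 1] (mod g)"
    and dvd: "\<And>n. p dvd pcompose p (newton_seq smult f q [:0, 1:] n)"
  shows "\<exists>c. [pcompose f (newton_seq smult f q [:0, 1:] n) = f ^ (2 ^ n) * c] (mod p)"
proof (induction n)
  case 0
  then show ?case by (intro exI[of _ 1]) simp
next
  case (Suc n)
  interpret P: unital_algebra "smult :: 'k \<Rightarrow> 'k poly \<Rightarrow> 'k poly" by (rule unital_algebra_smult)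
  define D where "D = newton_seq smult f q [:0, 1:] n"
  define F Q where "F = pcompose f D" and "Q = pcompose q D"
  obtain c where c: "[F = f ^ (2 ^ n) * c] (mod p)" using Suc unfolding F_def D_def by blast
  have "g dvd 1 - q * pderiv f" using q by (metis cong_iff_dvd_diff cong_sym)
  then obtain h where h: "1 - q * pderiv f = g * h" by (auto elim: dvdE)
  obtain w where "alg_eval smult f (D + (- (F * Q)))
      = alg_eval smult f D + (- (F * Q)) * alg_eval smult (pderiv f) D
        + (- (F * Q)) * (- (F * Q)) * w"
    using P.alg_eval_taylor[of D "- (F * Q)" f] by (auto simp: mult.commute)
  then have "pcompose f (D - F * Q) = F * pcompose (1 - q * pderiv f) D + F\<^sup>2 * (Q * Q * w)"
    by (simp add: alg_eval_smult_eq_pcompose F_def Q_def pcompose_diff pcompose_mult pcompose_1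
        power2_eq_square algebra_simps)
  also have "F * pcompose (1 - q * pderiv f) D = pcompose p D * pcompose h D"
    by (simp add: h p F_def pcompose_mult)
  finally have eq: "pcompose f (D - F * Q) = pcompose p D * pcompose h D + F\<^sup>2 * (Q * Q * w)" .
  have "[pcompose p D = 0] (mod p)" using dvd unfolding D_def by (simp add: cong_0_iff)
  then have "[pcompose f (D - F * Q) = 0 * pcompose h D + (f ^ (2 ^ n) * c)\<^sup>2 * (Q * Q * w)] (mod p)"
    unfolding eq by (intro cong_add cong_mult cong_pow c cong_refl)
  also have "0 * pcompose h D + (f ^ (2 ^ n) * c)\<^sup>2 * (Q * Q * w)
      = f ^ (2 ^ Suc n) * (c\<^sup>2 * (Q * Q * w))"
    by (simp add: power_mult_distrib mult.assoc mult.commute[of 2 "2 ^ n"] power_mult)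
  finally show ?case
    by (auto simp: alg_eval_smult_eq_pcompose F_def Q_def D_def)
qed

section \<open>Nilpotent elements and the Jordan-Chevalley decomposition\<close>

text \<open>Substituting the equation into itself gives \<open>e = e ^ Suc n * z ^ n\<close> for all
  \<open>n\<close>. Here \<open>z\<close> is arbitrary, to fit the unspecified Taylor
  remainder.\<close>

lemma nilpotent_eq_zero_of_square_factor:
  fixes e :: "'a::{ring, monoid_mult}"
  assumes "nilpotent e" "e = e * e * z"
  shows "e = 0"
proof -
  have "e = e ^ Suc n * z ^ n" for n
  proof (induction n)
    case (Suc n)
    have "e ^ Suc n = e ^ Suc (Suc n) * z"
      using assms(2) by (metis mult.assoc power_Suc2)
    then show ?case using Suc by (metis mult.assoc power_Suc)
  qed simp
  moreover obtain n where "e ^ n = 0" using assms(1) by (auto simp: nilpotent_def)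
  ultimately show ?thesis by (metis mult_zero_left mult_zero_right power_Suc)
qed

text \<open>It is the product \<open>e * v\<close> that commutes with \<open>e\<close>: in the
  application this product is a polynomial value, while its cofactor \<open>v\<close> is not under
  control. Moving \<open>e * v\<close> past powers of \<open>e\<close> gives
  \<open>(e * v) ^ n = e ^ n * v ^ n\<close>.\<close>

lemma nilpotent_mult:
  fixes e v :: "'a::{ring, monoid_mult}"
  assumes "nilpotent e" "(e * v) * e = e * (e * v)"
  shows "nilpotent (e * v)"
proof -
  have "(e * v) ^ n = e ^ n * v ^ n" for n
  proof (induction n)
    case (Suc n)
    have "(e * v) * e ^ n = e ^ n * (e * v)"
      using assms(2) by (metis power_commuting_commutes)
    then have "(e * v) ^ Suc n = e ^ n * (e * v) * v ^ n"
      using Suc by (metis mult.assoc power_Suc)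
    then show ?case by (simp only: power_Suc2[of e] power_Suc[of v] mult.assoc)
  qed simp
  then show ?thesis using assms(1) unfolding nilpotent_def by (metis mult_zero_left)
qed

lemma nilpotent_diff_commuting:
  fixes a b :: "'a::{ring, monoid_mult}"
  assumes "nilpotent a" "nilpotent b" "a * b = b * a"
  shows "nilpotent (a - b)"
proof -
  obtain k l where k: "k > 0" "a ^ k = 0" and l: "b ^ l = 0"
    using assms by (auto simp: nilpotent_def)
  \<comment> \<open>Binomial expansion one factor at a time, the prefix recording a term; once all
    factors are used up, \<open>i + j = k + l\<close> forces \<open>i \<ge> k\<close> or
    \<open>j \<ge> l\<close>.\<close>
  have "a ^ i * b ^ j * (a - b) ^ n = 0" if "i + j + n = k + l" for i j n
    using that
  proof (induction n arbitrary: i j)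
    case 0
    then consider "i \<ge> k" | "j \<ge> l" by linarith
    then have "a ^ i = 0 \<or> b ^ j = 0"
      using k l by cases (metis le_add_diff_inverse power_add mult_zero_left)+
    then show ?case by auto
  next
    case (Suc n)
    have "a ^ i * b ^ j * a = a ^ Suc i * b ^ j"
      using assms(3) by (metis mult.assoc power_Suc2 power_commuting_commutes)
    then have "a ^ i * b ^ j * (a - b) = a ^ Suc i * b ^ j - a ^ i * b ^ Suc j"
      by (simp add: right_diff_distrib mult.assoc power_commutes)
    then have "a ^ i * b ^ j * (a - b) ^ Suc n
        = a ^ Suc i * b ^ j * (a - b) ^ n - a ^ i * b ^ Suc j * (a - b) ^ n"
      by (metis left_diff_distrib mult.assoc power_Suc)
    then show ?case using Suc.IH[of "Suc i" j] Suc.IH[of i "Suc j"] Suc.prems by simp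
  qed
  from this[of 0 0 "k + l"] have "(a - b) ^ (k + l) = 0" by simp
  then show ?thesis using k unfolding nilpotent_def by (metis add_gr_0)
qed

lemma (in unital_algebra) semisimple_eq_of_nilpotent_diff:
  assumes f: "comaximal f (pderiv f)" "alg_eval scale f d = 0"
    and g: "comaximal g (pderiv g)" "alg_eval scale g d' = 0"
    and comm: "d * d' = d' * d" and nil: "nilpotent (d' - d)"
  shows "d' = d"
proof -
  define e where "e = d' - d"
  have de: "d * e = e * d" and d'e: "e * d' = d' * e" and d': "d' = d + e"
    using comm by (simp_all add: e_def algebra_simps)
  obtain w where w: "alg_eval scale f d' = e * alg_eval scale (pderiv f) d + e * e * w"
    using alg_eval_taylor[OF de, of f] f(2) d' by auto
  then have fd': "alg_eval scale f d' = e * (alg_eval scale (pderiv f) d + e * w)"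
    by (simp add: distrib_left mult.assoc)
  have "nilpotent (alg_eval scale f d')"
    unfolding fd' using nil alg_eval_commute[OF d'e, of f]
    by (intro nilpotent_mult) (simp_all add: e_def[symmetric] fd')
  then obtain n where n: "alg_eval scale f d' ^ n = 0" by (auto simp: nilpotent_def)
  \<comment> \<open>The polynomial \<open>t\<close> vanishes at \<open>d'\<close> because
    \<open>g\<close> and \<open>f ^ n\<close> do, and then so does its multiple
    \<open>f\<close>.\<close>
  obtain t a b where t: "t = a * g + b * f ^ n" "t dvd f"
    using separable_poly_dvd_lincomb_power[OF g(1)] by blast
  have "alg_eval scale t d' = 0"
    by (simp add: t(1) alg_eval_add alg_eval_mult alg_eval_power g n)
  then have fd'0: "alg_eval scale f d' = 0" using t(2) alg_eval_dvd_eq_0 by blast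
  obtain x y where "x * f + y * pderiv f = 1" using f(1) by (auto simp: comaximal_def)
  \<comment> \<open>The factors are swapped to get a right inverse, which cancels the derivative in
    \<open>e * alg_eval scale (pderiv f) d\<close>.\<close>
  then have "alg_eval scale (f * x + pderiv f * y) d = 1" by (simp add: mult.commute alg_eval_1)
  then have inv: "alg_eval scale (pderiv f) d * alg_eval scale y d = 1"
    by (simp add: alg_eval_add alg_eval_mult f(2))
  have "e * alg_eval scale (pderiv f) d = - (e * e * w)"
    using w fd'0 by (simp add: eq_neg_iff_add_eq_0)
  then have "e = - (e * e * w) * alg_eval scale y d" using inv by (metis mult.assoc mult_1_right)
  also have "\<dots> = e * e * (- (w * alg_eval scale y d))" by (simp add: mult.assoc)
  finally have "e = 0" using nil nilpotent_eq_zero_of_square_factor unfolding e_def by blast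
  then show ?thesis by (simp add: d')
qed

theorem theorem1:
  fixes scale :: "'k::field \<Rightarrow> 'a::{ring, monoid_mult} \<Rightarrow> 'a"
    and u :: 'a
    and p pt pb :: "'k poly"
    and ps :: "nat \<Rightarrow> 'k poly"
    and ms :: "nat \<Rightarrow> nat"
    and r m N :: nat
  assumes "unital_algebra scale"
    and "separable_element scale u"
    and "lead_coeff p = 1"
    and "alg_eval scale p u = 0"
    and "r \<ge> 1"
    and "p = (\<Prod>j\<in>{1..r}. ps j ^ ms j)"
    and "inj_on ps {1..r}"
    and "\<And>j. j \<in> {1..r} \<Longrightarrow> irreducible (ps j)"
    and "\<And>j. j \<in> {1..r} \<Longrightarrow> lead_coeff (ps j) = 1"
    and "\<And>j. j \<in> {1..r} \<Longrightarrow> separable_poly (ps j)"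
    and "\<And>j. j \<in> {1..r} \<Longrightarrow> ms j \<ge> 1"
    and "m = Max (ms ` {1..r})"
    and "pt = (\<Prod>j\<in>{1..r}. ps j)"
    and "pb = p div pt"
    and "N = (LEAST n. 2 ^ n \<ge> m)"
  shows "separable_poly pt \<and>
    (\<exists>q. [q * pderiv pt = 1] (mod pb)) \<and>
    (\<forall>q. [q * pderiv pt = 1] (mod pb) \<longrightarrow>
      (let d = newton_seq scale pt q u in
        alg_eval scale pt (d N) = 0 \<and>
        absolutely_semisimple scale (d N) \<and>
        nilpotent (u - d N) \<and>
        commutator (d N) (u - d N) = 0 \<and>
        Jordan_Chevalley scale u (d N) (u - d N) \<and>
        (\<forall>d' s'. Jordan_Chevalley scale u d' s' \<longrightarrow> d' = d N \<and> s' = u - d N)))"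
proof -
  interpret unital_algebra scale by fact
  have sep: "comaximal (ps j) (pderiv (ps j))" "degree (ps j) > 0" if "j \<in> {1..r}" for j
    using assms(10)[OF that] by (simp_all add: separable_poly_iff_comaximal)
  have "comaximal (ps i) (ps j)" if "i \<in> {1..r}" "j \<in> {1..r}" "i \<noteq> j" for i j
    using that assms(7-9) by (intro comaximal_monic_irreducible) (auto dest: inj_onD)
  then have cpt: "comaximal pt (pderiv pt)"
    unfolding assms(13) using sep by (intro comaximal_pderiv_prod) auto
  have nz: "ps j \<noteq> 0" if "j \<in> {1..r}" for j using sep(2)[OF that] by auto
  have "pt \<noteq> 0" unfolding assms(13) using nz by simp
  \<comment> \<open>A first factor exists since \<open>r \<ge> 1\<close>, and it makes
    \<open>pt\<close> non-constant.\<close>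
  have "ps 1 dvd pt" unfolding assms(13) using assms(5) by (intro dvd_prodI) auto
  then have "degree (ps 1) \<le> degree pt" using \<open>pt \<noteq> 0\<close> by (rule dvd_imp_degree_le)
  then have "degree pt > 0" using sep(2)[of 1] assms(5) by simp
  then have sep_pt: "separable_poly pt" using cpt by (simp add: separable_poly_iff_comaximal)

  have "pt dvd p" unfolding assms(6,13)
  proof (rule prod_dvd_prod)
    fix j assume "j \<in> {1..r}"
    then show "ps j dvd ps j ^ ms j" using assms(11)[of j] by (intro dvd_power) auto
  qed
  then have p: "p = pt * pb" unfolding assms(14) by simp
  have "p dvd (\<Prod>j\<in>{1..r}. ps j ^ m)"
    unfolding assms(6,12) by (intro prod_dvd_prod le_imp_power_dvd Max_ge) auto
  then have p_dvd: "p dvd pt ^ m" by (simp add: assms(13) prod_power_distrib)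
  \<comment> \<open>Dividing a power of \<open>pt\<close>, the polynomial \<open>pb\<close> inherits
    from \<open>pt\<close> the comaximality with \<open>pderiv pt\<close>.\<close>
  have "pb dvd pt ^ m" using p p_dvd by (metis dvd_mult_right)
  then have "comaximal (pderiv pt) pb"
    using comaximal_dvd_right comaximal_power_right comaximal_sym cpt by blast
  then obtain x y where "x * pderiv pt + y * pb = 1" by (auto simp: comaximal_def)
  then have "x * pderiv pt - 1 = pb * (- y)" by (simp add: algebra_simps)
  then have ex: "\<exists>q. [q * pderiv pt = 1] (mod pb)"
    by (metis cong_iff_dvd_diff dvd_triv_left)

  have "\<exists>n. m \<le> 2 ^ n" using less_exp[of m] less_imp_le by blast
  then have "m \<le> 2 ^ N" unfolding assms(15) by (rule LeastI_ex)
  then have p_dvd_N: "p dvd pt ^ (2 ^ N)" using p_dvd le_imp_power_dvd dvd_trans by blast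

  have main: "alg_eval scale pt d = 0 \<and> absolutely_semisimple scale d \<and> nilpotent (u - d) \<and>
      commutator d (u - d) = 0 \<and> Jordan_Chevalley scale u d (u - d) \<and>
      (\<forall>d' s'. Jordan_Chevalley scale u d' s' \<longrightarrow> d' = d \<and> s' = u - d)"
    if q: "[q * pderiv pt = 1] (mod pb)" and d_def: "d = newton_seq scale pt q u N" for q d
  proof -
    define D where "D = newton_seq smult pt q [:0, 1:]"
    have d: "d = alg_eval scale (D N) u"
      unfolding d_def D_def by (rule newton_seq_eq_alg_eval)
    have cong_X: "[D n = [:0, 1:]] (mod pt)" for n
      unfolding D_def by (rule newton_seq_poly_cong_X)
    \<comment> \<open>The iterate is known modulo \<open>pt\<close> only, so \<open>p\<close> is
      treated factor by factor: each \<open>ps j\<close> divides its own composite, and powers and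
      products preserve this.\<close>
    have "p dvd pcompose p (D n)" for n
    proof -
      have "ps j dvd pcompose (ps j) (D n)" if "j \<in> {1..r}" for j
      proof -
        have "ps j dvd pt" unfolding assms(13) using that by (intro dvd_prodI) auto
        then have "[D n = [:0, 1:]] (mod ps j)" using cong_X cong_dvd_modulus by blast
        then have "[pcompose (ps j) (D n) = pcompose (ps j) [:0, 1:]] (mod ps j)"
          by (rule cong_pcompose)
        then show ?thesis by (simp add: cong_def mod_eq_0_iff_dvd)
      qed
      then show ?thesis
        unfolding assms(6) pcompose_prod pcompose_power
        by (intro prod_dvd_prod dvd_power_same) auto
    qed
    then obtain c where c: "[pcompose pt (D N) = pt ^ (2 ^ N) * c] (mod p)"
      using newton_seq_poly_quadratic[OF p q, of N] unfolding D_def by blast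
    have "p dvd pcompose pt (D N)" using c p_dvd_N by (metis cong_dvd_iff dvd_mult2)
    then have "alg_eval scale (pcompose pt (D N)) u = 0" using assms(4) alg_eval_dvd_eq_0 by blast
    then have ptd: "alg_eval scale pt d = 0" by (simp add: alg_eval_pcompose d)
    then have ss: "absolutely_semisimple scale d"
      using sep_pt unfolding absolutely_semisimple_def by blast
    have ud: "u - d = alg_eval scale ([:0, 1:] - D N) u" by (simp add: alg_eval_diff alg_eval_X d)
    have "pt dvd [:0, 1:] - D N" using cong_X[of N] by (metis cong_iff_dvd_diff cong_sym)
    \<comment> \<open>The exponent with \<open>p dvd pt ^ (2 ^ N)\<close> serves for every multiple
      of \<open>pt\<close>.\<close>
    then have "p dvd ([:0, 1:] - D N) ^ (2 ^ N)" using p_dvd_N dvd_power_same dvd_trans by blast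
    then have "(u - d) ^ (2 ^ N) = 0"
      unfolding ud alg_eval_power[symmetric] using assms(4) alg_eval_dvd_eq_0 by blast
    then have nil: "nilpotent (u - d)" unfolding nilpotent_def by (metis zero_less_power zero_less_numeral)
    have "d * u = u * d" unfolding d by (rule alg_eval_commute[symmetric]) simp
    then have comm: "commutator d (u - d) = 0" by (simp add: commutator_def algebra_simps)
    have "d' = d \<and> s' = u - d" if JC: "Jordan_Chevalley scale u d' s'" for d' s'
    proof -
      obtain g where g: "comaximal g (pderiv g)" "alg_eval scale g d' = 0"
        using JC by (auto simp: Jordan_Chevalley_def absolutely_semisimple_def
            separable_poly_iff_comaximal)
      have u: "u = d' + s'" and s': "nilpotent s'" and ds: "d' * s' = s' * d'"
        using JC by (auto simp: Jordan_Chevalley_def commutator_def)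
      \<comment> \<open>Both \<open>d\<close> and \<open>u - d\<close> are polynomials in
        \<open>u\<close>, so whatever commutes with \<open>u\<close> commutes with them.\<close>
      have d'u: "d' * u = u * d'" and s'u: "s' * u = u * s'"
        unfolding u using ds by (simp_all add: algebra_simps)
      have "d * d' = d' * d" unfolding d using alg_eval_commute[OF d'u] by simp
      moreover have "(u - d) * s' = s' * (u - d)" unfolding ud using alg_eval_commute[OF s'u] by simp
      \<comment> \<open>This difference of commuting nilpotents is \<open>d' - d\<close>.\<close>
      then have "nilpotent ((u - d) - s')" by (rule nilpotent_diff_commuting[OF nil s'])
      then have "nilpotent (d' - d)" by (simp add: u)
      ultimately have "d' = d" using semisimple_eq_of_nilpotent_diff[OF cpt ptd g] by blast
      then show ?thesis using u by simp
    qed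
    moreover have "Jordan_Chevalley scale u d (u - d)"
      using ss nil comm by (simp add: Jordan_Chevalley_def)
    ultimately show ?thesis using ptd ss nil comm by blast
  qed
  show ?thesis unfolding Let_def using sep_pt ex main by blast
qed

end
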